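(* Let $\beta\in(0,\infty)$, $\gamma>0$, and for each $N\ge1$ let $K=K_N$ with $K_N/N\to\beta$. Let $\boldsymbol S=[\boldsymbol s_1,\dots,\boldsymbol s_K]\in\mathbb{R}^{N\times K}$ be a random time-hopping matrix with $N_{\mathsf s}=1$: its columns are independent, $\boldsymbol s_k=\epsilon_k\boldsymbol e_{\pi_k}$ with $\pi_k$ uniform on $\{1,\dots,N\}$ and $\epsilon_k$ uniform on $\{-1,+1\}$, all independent. Consider $\boldsymbol y=\boldsymbol S\boldsymbol b+\boldsymbol n$ with $\boldsymbol b$ having i.i.d. $\mathcal{CN}(0,\mathcal E)$ entries, $\boldsymbol n\sim\mathcal{CN}(\boldsymbol0,\mathcal N_0\boldsymbol I_N)$, $\boldsymbol b,\boldsymbol n,\boldsymbol S$ independent, and $\gamma=\mathcal E/\mathcal N_0$. For $\alpha\ge0$ let $\boldsymbol W^{\mathsf T}(\alpha)=\boldsymbol S^{\mathsf T}(\boldsymbol S\boldsymbol S^{\mathsf T}+\alpha\boldsymbol I)^{-1}$ for $\alpha>0$, and $\boldsymbol W^{\mathsf T}(0)=\lim_{\alpha\to0^+}\boldsymbol W^{\mathsf T}(\alpha)=\boldsymbol S^{+}$ (Moore–Penrose pseudoinverse). Let $r_1$ be the first entry of $\boldsymbol W^{\mathsf T}(\alpha)\boldsymbol y$, with either $\alpha=0$ (decorrelator) or $\alpha=1/\gamma$ (MMSE). Then, as $N\to\infty$, \[ \beta\,I(\mathsf b_1;r_1\mid\boldsymbol S)\ \to\ \beta\sum_{k\ge0}\frac{\beta^k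 e^{-\beta}}{k!}\log_2\!\Big(1+\frac{\gamma}{k\gamma+1}\Big), \] mutual information being in bits; in particular the limit does not depend on $\alpha$.
   Context: $\boldsymbol e_i$ denotes the $i$th standard basis vector of $\mathbb R^N$; $\mathcal{CN}$ denotes the circularly symmetric complex Gaussian distribution. *)

theory Defs
  imports "HOL-Probability.Probability" "Jordan_Normal_Form.Gauss_Jordan_Elimination"
begin

definition cn_density :: "real \<Rightarrow> complex \<Rightarrow> real" where
  "cn_density v z = exp (- (cmod z * cmod z) / v) / (pi * v)"

definition CN :: "real \<Rightarrow> complex measure" where
  "CN v = density lborel (\<lambda>z. ennreal (cn_density v z))"

text \<open>Randomness of (b, n): coordinates 0..K-1 are b_1..b_K (variance Es),
  coordinates K..K+N-1 are n_1..n_N (variance N0); all independent.\<close>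
definition noise_space :: "nat \<Rightarrow> nat \<Rightarrow> real \<Rightarrow> real \<Rightarrow> (nat \<Rightarrow> complex) measure" where
  "noise_space N K Es N0 = PiM {..<K+N} (\<lambda>i. if i < K then CN Es else CN N0)"

text \<open>Time-hopping configurations (N_s = 1): column k has its nonzero entry
  eps_k in row pi_k. A configuration c maps k to (pi_k, eps_k).\<close>
definition th_configs :: "nat \<Rightarrow> nat \<Rightarrow> (nat \<Rightarrow> nat \<times> real) set" where
  "th_configs N K = {..<K} \<rightarrow>\<^sub>E ({..<N} \<times> {-1, 1})"

definition th_matrix :: "nat \<Rightarrow> nat \<Rightarrow> (nat \<Rightarrow> nat \<times> real) \<Rightarrow> real mat" where
  "th_matrix N K c = mat N K (\<lambda>(i,k). if fst (c k) = i then snd (c k) else 0)"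

definition WT_pos :: "real \<Rightarrow> real mat \<Rightarrow> real mat" where
  "WT_pos a S = transpose_mat S * the (mat_inverse (S * transpose_mat S + a \<cdot>\<^sub>m 1\<^sub>m (dim_row S)))"

definition WT :: "real \<Rightarrow> real mat \<Rightarrow> real mat" where
  "WT a S = (if a > 0 then WT_pos a S
             else mat (dim_col S) (dim_row S) (\<lambda>(i,j). Lim (at_right 0) (\<lambda>t. WT_pos t S $$ (i,j))))"

definition r1 :: "real \<Rightarrow> real mat \<Rightarrow> (nat \<Rightarrow> complex) \<Rightarrow> complex" where
  "r1 a S \<omega> = (\<Sum>j<dim_row S. complex_of_real (WT a S $$ (0, j)) *
       ((\<Sum>k<dim_col S. complex_of_real (S $$ (j, k)) * \<omega> k) + \<omega> (dim_col S + j)))"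

definition MI_given_S :: "nat \<Rightarrow> nat \<Rightarrow> real \<Rightarrow> real \<Rightarrow> real \<Rightarrow> real mat \<Rightarrow> real" where
  "MI_given_S N K Es N0 a S =
     prob_space.mutual_information (noise_space N K Es N0) 2 borel borel (\<lambda>\<omega>. \<omega> 0) (r1 a S)"

definition cond_MI :: "nat \<Rightarrow> nat \<Rightarrow> real \<Rightarrow> real \<Rightarrow> real \<Rightarrow> real" where
  "cond_MI N K Es N0 a =
     (\<Sum>c\<in>th_configs N K. MI_given_S N K Es N0 a (th_matrix N K c)) / real (card (th_configs N K))"

end

theory Submission
  imports Defs "Jordan_Normal_Form.Determinant"
begin

text \<open>
  Since each column of the time-hopping matrix \<open>S\<close> has a single entry \<open>\<plusminus>1\<close>, the Gram matrix
  \<open>S S\<^sup>T\<close> is diagonal and counts the users per row. Hence, up to a positive factor that depends on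
  \<open>\<alpha>\<close> and does not affect the mutual information, \<open>r\<^sub>1\<close> is \<open>b\<^sub>1\<close> plus the signed symbols of the \<open>m\<close>
  other users in the same row plus one noise coordinate. This is a scalar Gaussian channel with
  mutual information \<open>log\<^sub>2 (1 + \<E> / (m \<E> + \<N>\<^sub>0))\<close>. Under uniform \<open>S\<close> the number \<open>m\<close> is
  binomial with parameters \<open>K - 1\<close> and \<open>1 / N\<close>, and the Poisson limit theorem, in the form of
  Tannery's theorem for a bounded test function, gives the limit.
\<close>

section \<open>Complex Gaussian densities\<close>

lemma cn_density_nonneg: "v > 0 \<Longrightarrow> cn_density v z \<ge> 0"
  by (simp add: cn_density_def)

lemma cn_density_pos: "v > 0 \<Longrightarrow> cn_density v z > 0"
  by (simp add: cn_density_def)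

lemma borel_measurable_cn_density [measurable]: "cn_density v \<in> borel_measurable borel"
  unfolding cn_density_def by measurable

text \<open>Circular symmetry splits the variance \<open>v\<close> evenly between independent real
  and imaginary parts, which reduces complex integrals to real ones.\<close>

lemma cn_density_eq_normal_density:
  assumes "v > 0"
  shows "cn_density v z =
    normal_density 0 (sqrt (v / 2)) (Re z) * normal_density 0 (sqrt (v / 2)) (Im z)"
proof -
  have "cmod z * cmod z = (Re z)\<^sup>2 + (Im z)\<^sup>2"
    by (metis cmod_power2 power2_eq_square)
  then show ?thesis
    using assms
    by (simp add: cn_density_def normal_density_def exp_add[symmetric] add_divide_distrib diff_divide_distrib)
qed

text \<open>Lebesgue measure on the complex plane is a product over the two basis vectors; the
  factor attached to 1 is \<open>f\<close>, the other one is \<open>g\<close>.\<close>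

lemma nn_integral_lborel_complex_times:
  assumes [measurable]: "f \<in> borel_measurable borel" "g \<in> borel_measurable borel"
  shows "(\<integral>\<^sup>+z. f (Re z) * g (Im z) \<partial>lborel) = (\<integral>\<^sup>+x. f x \<partial>lborel) * (\<integral>\<^sup>+x. g x \<partial>lborel)"
  using nn_integral_lborel_prod[of "\<lambda>b::complex. if b = 1 then f else g"]
  by (simp add: Basis_complex_def)

lemma nn_integral_normal_density:
  assumes "\<sigma> > 0"
  shows "(\<integral>\<^sup>+x. ennreal (normal_density 0 \<sigma> x) \<partial>lborel) = 1"
    and "(\<integral>\<^sup>+x. ennreal (normal_density 0 \<sigma> x * x\<^sup>2) \<partial>lborel) = ennreal (\<sigma>\<^sup>2)"
proof -
  show "(\<integral>\<^sup>+x. ennreal (normal_density 0 \<sigma> x) \<partial>lborel) = 1"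
    using assms by (subst nn_integral_eq_integral) (auto simp: integral_normal_density integrable_normal_density)
  have "has_bochner_integral lborel (\<lambda>x. normal_density 0 \<sigma> x * x\<^sup>2) (\<sigma>\<^sup>2)"
    using normal_moment_even[OF assms, of 0 1] by (simp add: fact_numeral numeral_2_eq_2)
  then show "(\<integral>\<^sup>+x. ennreal (normal_density 0 \<sigma> x * x\<^sup>2) \<partial>lborel) = ennreal (\<sigma>\<^sup>2)"
    by (subst nn_integral_eq_integral) (auto simp: has_bochner_integral_iff)
qed

lemma nn_integral_cn_density:
  assumes "v > 0"
  shows "(\<integral>\<^sup>+z. ennreal (cn_density v z) \<partial>lborel) = 1"
  using nn_integral_lborel_complex_times[of "normal_density 0 (sqrt (v/2))" "normal_density 0 (sqrt (v/2))"] assms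
  by (simp add: cn_density_eq_normal_density ennreal_mult nn_integral_normal_density)

text \<open>Each of the two real coordinates contributes \<open>v / 2\<close>. The value later
  cancels the quadratic terms of the information density.\<close>

lemma nn_integral_cn_density_norm_square:
  assumes "v > 0"
  shows "(\<integral>\<^sup>+z. ennreal (cn_density v z * (cmod z)\<^sup>2) \<partial>lborel) = ennreal v"
proof -
  let ?n = "normal_density 0 (sqrt (v/2))"
  have *: "ennreal (cn_density v z * (cmod z)\<^sup>2) =
      ennreal (?n (Re z) * (Re z)\<^sup>2) * ennreal (?n (Im z)) + ennreal (?n (Re z)) * ennreal (?n (Im z) * (Im z)\<^sup>2)" for z
    unfolding cmod_power2 cn_density_eq_normal_density[OF assms]
    by (simp add: ennreal_mult[symmetric] ennreal_plus[symmetric] algebra_simps del: ennreal_plus)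
  show ?thesis
    unfolding *
    using nn_integral_lborel_complex_times[of "\<lambda>x. ?n x * x\<^sup>2" "?n"] 
      nn_integral_lborel_complex_times[of "?n" "\<lambda>x. ?n x * x\<^sup>2"] assms
    by (simp add: nn_integral_add nn_integral_normal_density ennreal_plus[symmetric] del: ennreal_plus)
qed

text \<open>A real factor \<open>c\<close> stretches area in the complex plane by
  \<open>c\<^sup>2\<close>, the Jacobian on the left; the exponent is unchanged.\<close>

lemma cn_density_scale:
  assumes "c \<noteq> 0"
  shows "cn_density (c\<^sup>2 * v) (complex_of_real c * z) * c\<^sup>2 = cn_density v z"
proof -
  have "cmod (of_real c * z) * cmod (of_real c * z) / (c\<^sup>2 * v) = cmod z * cmod z / v"
    using assms by (simp add: norm_mult power2_eq_square abs_mult_self_eq algebra_simps)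
      (metis (no_types, lifting) abs_mult_self_eq assms mult.assoc mult_divide_mult_cancel_left no_zero_divisors)
  then show ?thesis
    using assms by (simp add: cn_density_def)
qed

text \<open>Completing the square in \<open>x\<close>; integrating out \<open>x\<close> then yields the convolution formula.\<close>
lemma cn_density_mult:
  fixes u s g :: real and x y :: complex
  assumes "u > 0" "s > 0"
  defines "t \<equiv> g\<^sup>2 * u + s"
  shows "cn_density u x * cn_density s (y - g * x) =
    cn_density t y * cn_density (u * s / t) (x - complex_of_real (g * u / t) * y)"
proof -
  have t: "t > 0"
    unfolding t_def by (intro add_nonneg_pos) (use assms in auto)
  have n: "cmod z * cmod z = (Re z)\<^sup>2 + (Im z)\<^sup>2" for z
    by (metis cmod_power2 power2_eq_square)
  \<comment> \<open>The quadratic identity is proved for reals, with denominators cleared by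
    \<open>u * s * t\<close>, and then applied to real and imaginary parts separately.\<close>
  have r: "a\<^sup>2 / u + (b - g * a)\<^sup>2 / s = b\<^sup>2 / t + (a - g * u / t * b)\<^sup>2 / (u * s / t)" for a b :: real
  proof -
    have "(a\<^sup>2 / u + (b - g * a)\<^sup>2 / s) * (u * s * t) = (a\<^sup>2 * s + (b - g * a)\<^sup>2 * u) * t"
      using assms t by (simp add: field_simps)
    also have "\<dots> = b\<^sup>2 * (u * s) + (a * t - g * u * b)\<^sup>2"
      unfolding t_def by (simp add: algebra_simps power2_eq_square)
    also have "(a * t - g * u * b)\<^sup>2 = t\<^sup>2 * (a - g * u / t * b)\<^sup>2"
      using t by (simp add: field_simps flip: power_mult_distrib)
    also have "b\<^sup>2 * (u * s) + \<dots> = (b\<^sup>2 / t + (a - g * u / t * b)\<^sup>2 / (u * s / t)) * (u * s * t)"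
    proof -
      have "p * (u * s) + t\<^sup>2 * q = (p / t + q / (u * s / t)) * (u * s * t)" if "t > 0" for p q t :: real
        using assms(1,2) that by (simp add: field_simps power2_eq_square)
      from this[OF t] show ?thesis .
    qed
    finally show ?thesis
      using assms t by simp
  qed
  have "cmod x * cmod x / u + cmod (y - g * x) * cmod (y - g * x) / s =
    cmod y * cmod y / t + cmod (x - complex_of_real (g * u / t) * y) * cmod (x - complex_of_real (g * u / t) * y) / (u * s / t)"
    using r[of "Re x" "Re y"] r[of "Im x" "Im y"]
    unfolding n by (simp add: add_divide_distrib distrib_right)
  then have e: "exp (- (cmod x * cmod x) / u) * exp (- (cmod (y - g * x) * cmod (y - g * x)) / s) =
    exp (- (cmod y * cmod y) / t) *
    exp (- (cmod (x - complex_of_real (g * u / t) * y) * cmod (x - complex_of_real (g * u / t) * y)) / (u * s / t))"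
    unfolding exp_add[symmetric] minus_divide_left[symmetric] minus_add_distrib[symmetric] by simp
  \<comment> \<open>The normalising constants agree too, because \<open>t\<close> cancels in the
    product of the two variances.\<close>
  have "(pi * u) * (pi * s) = (pi * t) * (pi * (u * s / t))"
    using t by simp
  then show ?thesis
    unfolding cn_density_def times_divide_times_eq e by simp
qed

lemma nn_integral_lborel_translate:
  fixes f :: "'a::euclidean_space \<Rightarrow> ennreal"
  assumes [measurable]: "f \<in> borel_measurable borel"
  shows "(\<integral>\<^sup>+x. f (x - c) \<partial>lborel) = (\<integral>\<^sup>+x. f x \<partial>lborel)"
proof -
  have "(\<integral>\<^sup>+x. f x \<partial>lborel) = (\<integral>\<^sup>+x. f x \<partial>distr lborel borel ((+) (-c)))"
    by (simp add: lborel_distr_plus)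
  also have "\<dots> = (\<integral>\<^sup>+x. f (x - c) \<partial>lborel)"
    by (subst nn_integral_distr) auto
  finally show ?thesis ..
qed

text \<open>After completing the square, the factor in \<open>y\<close> leaves the integral and the
  remaining factor is a translated Gaussian density of mass one.\<close>

lemma nn_integral_cn_density_convolution:
  assumes "u > 0" "s > 0"
  shows "(\<integral>\<^sup>+x. ennreal (cn_density u x * cn_density s (y - complex_of_real g * x)) \<partial>lborel) = 
    ennreal (cn_density (g\<^sup>2 * u + s) y)"
proof -
  let ?t = "g\<^sup>2 * u + s"
  have t: "?t > 0"
    by (intro add_nonneg_pos) (use assms in auto)
  then have w: "u * s / ?t > 0"
    using assms by simp
  have "(\<integral>\<^sup>+x. ennreal (cn_density u x * cn_density s (y - complex_of_real g * x)) \<partial>lborel) =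
      (\<integral>\<^sup>+x. ennreal (cn_density ?t y) *
        ennreal (cn_density (u * s / ?t) (x - complex_of_real (g * u / ?t) * y)) \<partial>lborel)"
    by (intro nn_integral_cong, subst cn_density_mult[OF assms],
        subst ennreal_mult[OF cn_density_nonneg[OF t] cn_density_nonneg[OF w]]) simp
  also have "\<dots> = ennreal (cn_density ?t y) * (\<integral>\<^sup>+x. ennreal (cn_density (u * s / ?t) x) \<partial>lborel)"
    using nn_integral_lborel_translate[of "\<lambda>x. ennreal (cn_density (u * s / ?t) x)"]
    by (subst nn_integral_cmult) auto
  finally show ?thesis
    by (simp add: nn_integral_cn_density w)
qed

section \<open>The scalar Gaussian channel\<close>

lemma sets_CN [simp, measurable_cong]: "sets (CN v) = sets borel"
  by (simp add: CN_def)

lemma space_CN [simp]: "space (CN v) = UNIV"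
  by (simp add: CN_def)

lemma prob_space_CN:
  assumes "v > 0"
  shows "prob_space (CN v)"
  by (rule prob_spaceI) (simp add: CN_def emeasure_density nn_integral_cn_density[OF assms])

context prob_space
begin

text \<open>Densities are taken against \<open>lborel\<close> but laws on \<open>borel\<close>; both
  views agree because \<open>distr\<close> sees only the sets of its target.\<close>

lemma distributed_lborel_CN_iff:
  "distributed M lborel X (\<lambda>x. ennreal (cn_density v x)) \<longleftrightarrow>
    X \<in> borel_measurable M \<and> distr M borel X = CN v"
proof -
  have "distr M lborel X = distr M borel X"
    by (rule distr_cong) auto
  then show ?thesis
    by (auto simp: distributed_def CN_def)
qed

lemma expectation_norm_square_CN:
  assumes "v > 0" "X \<in> borel_measurable M" "distr M borel X = CN v"
  shows "integrable M (\<lambda>\<omega>. (cmod (X \<omega>))\<^sup>2)" "expectation (\<lambda>\<omega>. (cmod (X \<omega>))\<^sup>2) = v"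
proof -
  have "(\<integral>\<^sup>+\<omega>. ennreal ((cmod (X \<omega>))\<^sup>2) \<partial>M) = (\<integral>\<^sup>+z. ennreal ((cmod z)\<^sup>2) \<partial>distr M borel X)"
    using assms(2) by (subst nn_integral_distr) auto
  also have "\<dots> = (\<integral>\<^sup>+z. ennreal (cn_density v z * (cmod z)\<^sup>2) \<partial>lborel)"
    unfolding assms(3) CN_def
    by (subst nn_integral_density) (auto simp: ennreal_mult cn_density_nonneg[OF assms(1)])
  also have "\<dots> = ennreal v"
    by (rule nn_integral_cn_density_norm_square[OF assms(1)])
  finally have "has_bochner_integral M (\<lambda>\<omega>. (cmod (X \<omega>))\<^sup>2) v"
    using assms by (intro has_bochner_integral_nn_integral) auto
  then show "integrable M (\<lambda>\<omega>. (cmod (X \<omega>))\<^sup>2)" "expectation (\<lambda>\<omega>. (cmod (X \<omega>))\<^sup>2) = v"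
    by (auto simp: has_bochner_integral_iff)
qed

text \<open>Change of variables under an affine map of Lebesgue measure, whose Jacobian
  \<open>c\<^sup>2\<close> is absorbed by \<open>cn_density_scale\<close>.\<close>

lemma distr_scale_CN:
  assumes "c \<noteq> 0" and [measurable]: "X \<in> borel_measurable M" and X: "distr M borel X = CN v"
  shows "distr M borel (\<lambda>\<omega>. complex_of_real c * X \<omega>) = CN (c\<^sup>2 * v)"
proof (rule measure_eqI)
  fix A assume "A \<in> sets (distr M borel (\<lambda>\<omega>. complex_of_real c * X \<omega>))"
  then have [measurable]: "A \<in> sets borel" by simp
  have move: "ennreal (c\<^sup>2) * (ennreal x * y) = ennreal (x * c\<^sup>2) * y" for x y
    by (subst ennreal_mult'') (simp_all add: mult_ac)
  have "emeasure (CN (c\<^sup>2 * v)) A = (\<integral>\<^sup>+z. ennreal (cn_density (c\<^sup>2 * v) z) * indicator A z \<partial>lborel)"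
    by (simp add: CN_def emeasure_density)
  also have "\<dots> = (\<integral>\<^sup>+z. ennreal (cn_density (c\<^sup>2 * v) z) * indicator A z
      \<partial>density (distr lborel borel (\<lambda>z. 0 + c *\<^sub>R z)) (\<lambda>_. \<bar>c\<bar>^DIM(complex)))"
    by (subst lborel_affine[OF assms(1), of 0]) simp
  also have "\<dots> = (\<integral>\<^sup>+z. ennreal (c\<^sup>2) * (ennreal (cn_density (c\<^sup>2 * v) (of_real c * z)) * indicator A (of_real c * z)) \<partial>lborel)"
    by (subst nn_integral_density) (auto simp: nn_integral_distr scaleR_conv_of_real)
  also have "\<dots> = (\<integral>\<^sup>+z. ennreal (cn_density v z) * indicator A (of_real c * z) \<partial>lborel)"
    by (intro nn_integral_cong) (simp only: move cn_density_scale[OF assms(1)])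
  also have "\<dots> = (\<integral>\<^sup>+z. indicator A (of_real c * z) \<partial>distr M borel X)"
    unfolding X CN_def by (subst nn_integral_density) auto
  also have "\<dots> = (\<integral>\<^sup>+\<omega>. indicator A (of_real c * X \<omega>) \<partial>M)"
    by (subst nn_integral_distr) auto
  also have "\<dots> = emeasure (distr M borel (\<lambda>\<omega>. complex_of_real c * X \<omega>)) A"
    by (subst nn_integral_indicator[symmetric], simp, subst nn_integral_distr) auto
  finally show "emeasure (distr M borel (\<lambda>\<omega>. complex_of_real c * X \<omega>)) A = emeasure (CN (c\<^sup>2 * v)) A" ..
qed simp

text \<open>Given the input \<open>x\<close>, the output is \<open>W\<close> shifted by
  \<open>g * x\<close>. Independence turns the joint law into a product, and translating the inner
  integral exhibits the joint density. The general test function \<open>h\<close> serves both the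
  output law and the joint law.\<close>

lemma nn_integral_Gaussian_channel:
  assumes u: "u > 0" and s: "s > 0"
    and indep: "indep_var borel X borel W"
    and X: "distr M borel X = CN u" and W: "distr M borel W = CN s"
    and [measurable]: "h \<in> borel_measurable (borel \<Otimes>\<^sub>M borel)"
  shows "(\<integral>\<^sup>+\<omega>. h (X \<omega>, complex_of_real g * X \<omega> + W \<omega>) \<partial>M) =
    (\<integral>\<^sup>+x. (\<integral>\<^sup>+y. ennreal (cn_density u x * cn_density s (y - complex_of_real g * x)) * h (x, y) \<partial>lborel) \<partial>lborel)"
proof -
  have [measurable]: "X \<in> borel_measurable M" "W \<in> borel_measurable M"
    using indep_var_rv1[OF indep] indep_var_rv2[OF indep] by auto
  interpret CNs: prob_space "CN s" by (rule prob_space_CN[OF s])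
  have joint: "distr M (borel \<Otimes>\<^sub>M borel) (\<lambda>\<omega>. (X \<omega>, W \<omega>)) = CN u \<Otimes>\<^sub>M CN s"
    using indep X W by (simp add: indep_var_distribution_eq)
  have "(\<integral>\<^sup>+\<omega>. h (X \<omega>, complex_of_real g * X \<omega> + W \<omega>) \<partial>M) =
      (\<integral>\<^sup>+p. h (fst p, of_real g * fst p + snd p) \<partial>distr M (borel \<Otimes>\<^sub>M borel) (\<lambda>\<omega>. (X \<omega>, W \<omega>)))"
    by (subst nn_integral_distr) auto
  also have "\<dots> = (\<integral>\<^sup>+x. (\<integral>\<^sup>+z. h (x, of_real g * x + z) \<partial>CN s) \<partial>CN u)"
    unfolding joint by (subst CNs.nn_integral_fst[symmetric]) auto
  also have "\<dots> = (\<integral>\<^sup>+x. ennreal (cn_density u x) * (\<integral>\<^sup>+z. ennreal (cn_density s z) * h (x, of_real g * x + z) \<partial>lborel) \<partial>lborel)"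
    unfolding CN_def by (simp add: nn_integral_density)
  also have "\<dots> = (\<integral>\<^sup>+x. (\<integral>\<^sup>+y. ennreal (cn_density u x * cn_density s (y - of_real g * x)) * h (x, y) \<partial>lborel) \<partial>lborel)"
  proof (rule nn_integral_cong)
    fix x
    have "(\<integral>\<^sup>+z. ennreal (cn_density s z) * h (x, of_real g * x + z) \<partial>lborel) =
      (\<integral>\<^sup>+y. ennreal (cn_density s (y - of_real g * x)) * h (x, y) \<partial>lborel)"
      using nn_integral_lborel_translate[of "\<lambda>z. ennreal (cn_density s z) * h (x, of_real g * x + z)" "of_real g * x"]
      by simp
    then show "ennreal (cn_density u x) * (\<integral>\<^sup>+z. ennreal (cn_density s z) * h (x, of_real g * x + z) \<partial>lborel) =
      (\<integral>\<^sup>+y. ennreal (cn_density u x * cn_density s (y - of_real g * x)) * h (x, y) \<partial>lborel)"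
      by (simp add: ennreal_mult cn_density_nonneg u s mult.assoc nn_integral_cmult)
  qed
  finally show ?thesis .
qed

text \<open>Testing with a function of the output alone and exchanging the integrals leaves a
  Gaussian convolution.\<close>

lemma distr_Gaussian_channel_output:
  assumes "u > 0" "s > 0" and indep: "indep_var borel X borel W"
    and "distr M borel X = CN u" "distr M borel W = CN s"
  shows "distr M borel (\<lambda>\<omega>. complex_of_real g * X \<omega> + W \<omega>) = CN (g\<^sup>2 * u + s)"
proof (rule measure_eqI)
  have [measurable]: "X \<in> borel_measurable M" "W \<in> borel_measurable M"
    using indep_var_rv1[OF indep] indep_var_rv2[OF indep] by auto
  let ?Y = "\<lambda>\<omega>. complex_of_real g * X \<omega> + W \<omega>"
  fix A assume "A \<in> sets (distr M borel ?Y)"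
  then have [measurable]: "A \<in> sets borel" by simp
  have "emeasure (distr M borel ?Y) A = (\<integral>\<^sup>+\<omega>. indicator A (snd (X \<omega>, ?Y \<omega>)) \<partial>M)"
    by (subst nn_integral_indicator[symmetric], simp, subst nn_integral_distr) auto
  also have "\<dots> = (\<integral>\<^sup>+x. (\<integral>\<^sup>+y. ennreal (cn_density u x * cn_density s (y - complex_of_real g * x)) * indicator A y \<partial>lborel) \<partial>lborel)"
    using nn_integral_Gaussian_channel[OF assms, of "\<lambda>p. indicator A (snd p)" g] by simp
  also have "\<dots> = (\<integral>\<^sup>+y. (\<integral>\<^sup>+x. ennreal (cn_density u x * cn_density s (y - complex_of_real g * x)) * indicator A y \<partial>lborel) \<partial>lborel)"
    by (rule lborel_pair.Fubini') simp
  also have "\<dots> = (\<integral>\<^sup>+y. ennreal (cn_density (g\<^sup>2 * u + s) y) * indicator A y \<partial>lborel)"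
    by (simp add: nn_integral_multc nn_integral_cn_density_convolution assms)
  also have "\<dots> = emeasure (CN (g\<^sup>2 * u + s)) A"
    by (simp add: CN_def emeasure_density)
  finally show "emeasure (distr M borel ?Y) A = emeasure (CN (g\<^sup>2 * u + s)) A" .
qed simp

lemma distributed_Gaussian_channel:
  assumes "u > 0" "s > 0" and indep: "indep_var borel X borel W"
    and "distr M borel X = CN u" "distr M borel W = CN s"
  shows "distributed M (lborel \<Otimes>\<^sub>M lborel) (\<lambda>\<omega>. (X \<omega>, complex_of_real g * X \<omega> + W \<omega>))
    (\<lambda>p. ennreal (cn_density u (fst p) * cn_density s (snd p - complex_of_real g * fst p)))"
proof -
  have [measurable]: "X \<in> borel_measurable M" "W \<in> borel_measurable M"
    using indep_var_rv1[OF indep] indep_var_rv2[OF indep] by auto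
  let ?XY = "\<lambda>\<omega>. (X \<omega>, complex_of_real g * X \<omega> + W \<omega>)"
  let ?d = "\<lambda>p. ennreal (cn_density u (fst p) * cn_density s (snd p - complex_of_real g * fst p))"
  have "distr M (lborel \<Otimes>\<^sub>M lborel) ?XY = density (lborel \<Otimes>\<^sub>M lborel) ?d"
  proof (rule measure_eqI)
    fix A assume "A \<in> sets (distr M (lborel \<Otimes>\<^sub>M lborel) ?XY)"
    then have [measurable]: "A \<in> sets (borel \<Otimes>\<^sub>M borel)" by simp
    have "emeasure (distr M (lborel \<Otimes>\<^sub>M lborel) ?XY) A = (\<integral>\<^sup>+\<omega>. indicator A (?XY \<omega>) \<partial>M)"
      by (subst nn_integral_indicator[symmetric], simp, subst nn_integral_distr) auto
    also have "\<dots> = (\<integral>\<^sup>+p. ?d p * indicator A p \<partial>(lborel \<Otimes>\<^sub>M lborel))"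
      by (subst nn_integral_Gaussian_channel[OF assms], simp, subst lborel.nn_integral_fst[symmetric]) auto
    also have "\<dots> = emeasure (density (lborel \<Otimes>\<^sub>M lborel) ?d) A"
      by (subst emeasure_density) auto
    finally show "emeasure (distr M (lborel \<Otimes>\<^sub>M lborel) ?XY) A = emeasure (density (lborel \<Otimes>\<^sub>M lborel) ?d) A" .
  qed simp
  then show ?thesis
    by (simp add: distributed_def)
qed

text \<open>In the log-ratio of the joint density to the product of the marginals the density of
  \<open>X\<close> cancels. What remains is a constant plus, up to the factor
  \<open>1 / ln 2\<close>, the difference of the normalised powers of \<open>Y\<close> and
  \<open>W\<close>. Both powers have expectation one, so only the constant survives.\<close>

lemma mutual_information_Gaussian_channel:
  assumes u: "u > 0" and s: "s > 0" and indep: "indep_var borel X borel W"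
    and X: "distr M borel X = CN u" and W: "distr M borel W = CN s"
  shows "mutual_information 2 borel borel X (\<lambda>\<omega>. complex_of_real g * X \<omega> + W \<omega>) =
    log 2 (1 + g\<^sup>2 * u / s)"
proof -
  interpret information_space M 2
    by unfold_locales simp
  have [measurable]: "X \<in> borel_measurable M" "W \<in> borel_measurable M"
    using indep_var_rv1[OF indep] indep_var_rv2[OF indep] by auto
  define Y where "Y = (\<lambda>\<omega>. complex_of_real g * X \<omega> + W \<omega>)"
  have [measurable]: "Y \<in> borel_measurable M"
    unfolding Y_def by measurable
  define t where "t = g\<^sup>2 * u + s"
  have t: "t > 0"
    unfolding t_def by (intro add_nonneg_pos) (use assms in auto)
  have Y: "distr M borel Y = CN t"
    unfolding Y_def t_def by (rule distr_Gaussian_channel_output[OF u s indep X W])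
  define d where "d = (\<lambda>p. cn_density u (fst p) * cn_density s (snd p - complex_of_real g * fst p))"
  have [measurable]: "d \<in> borel_measurable (lborel \<Otimes>\<^sub>M lborel)"
    unfolding d_def by measurable
  have d_nonneg: "d p \<ge> 0" for p
    by (simp add: d_def cn_density_nonneg u s)
  have XY: "distributed M (lborel \<Otimes>\<^sub>M lborel) (\<lambda>\<omega>. (X \<omega>, Y \<omega>)) (\<lambda>p. ennreal (d p))"
    unfolding Y_def d_def by (rule distributed_Gaussian_channel[OF u s indep X W])
  let ?L = "\<lambda>p. log 2 (d p / (cn_density u (fst p) * cn_density t (snd p)))"
  have L: "?L (X \<omega>, Y \<omega>) = log 2 (t / s) + ((cmod (Y \<omega>))\<^sup>2 / t - (cmod (W \<omega>))\<^sup>2 / s) / ln 2" for \<omega>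
  proof -
    have "d (X \<omega>, Y \<omega>) / (cn_density u (X \<omega>) * cn_density t (Y \<omega>)) =
      cn_density s (W \<omega>) / cn_density t (Y \<omega>)"
      using cn_density_pos[OF u, of "X \<omega>"] by (simp add: d_def Y_def)
    also have "\<dots> = t / s * exp ((cmod (Y \<omega>))\<^sup>2 / t - (cmod (W \<omega>))\<^sup>2 / s)"
    proof -
      have "exp ((cmod (Y \<omega>))\<^sup>2 / t - (cmod (W \<omega>))\<^sup>2 / s) =
        exp (- (cmod (W \<omega>) * cmod (W \<omega>)) / s) / exp (- (cmod (Y \<omega>) * cmod (Y \<omega>)) / t)"
        by (simp add: exp_diff[symmetric] power2_eq_square)
      then show ?thesis
        using t s by (simp add: cn_density_def)
    qed
    finally show ?thesis
      using t s by (simp add: log_def ln_mult ln_div add_divide_distrib diff_divide_distrib)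
  qed
  have "mutual_information 2 borel borel X Y = mutual_information 2 lborel lborel X Y"
  proof -
    have "distr M borel X = distr M lborel X" "distr M borel Y = distr M lborel Y"
      "distr M (borel \<Otimes>\<^sub>M borel) (\<lambda>x. (X x, Y x)) = distr M (lborel \<Otimes>\<^sub>M lborel) (\<lambda>x. (X x, Y x))"
      by (auto intro!: distr_cong sets_pair_measure_cong)
    then show ?thesis
      by (simp add: mutual_information_def)
  qed
  also have "\<dots> = (\<integral>p. d p * ?L p \<partial>(lborel \<Otimes>\<^sub>M lborel))"
    using X Y XY
    by (intro mutual_information_distr)
      (auto simp: distributed_lborel_CN_iff cn_density_nonneg u t d_nonneg lborel.sigma_finite_measure_axioms)
  \<comment> \<open>Returning to the probability space makes the pointwise formula \<open>L\<close>
    applicable, so that only second moments have to be known.\<close>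
  also have "\<dots> = expectation (\<lambda>\<omega>. ?L (X \<omega>, Y \<omega>))"
    by (rule distributed_integral[OF XY]) (auto simp: d_nonneg)
  also have "\<dots> = log 2 (t / s)"
    unfolding L
    using expectation_norm_square_CN[OF t _ Y] expectation_norm_square_CN[OF s _ W] t s
    by (simp add: prob_space)
  also have "t / s = 1 + g\<^sup>2 * u / s"
    using s by (simp add: t_def add_divide_distrib)
  finally show ?thesis
    by (simp add: Y_def)
qed

end

section \<open>Linear combinations of independent complex Gaussians\<close>

context prob_space
begin

text \<open>The restrictions to the disjoint index blocks \<open>{i}\<close> and \<open>I\<close>
  are independent, and the two variables are measurable functions of them.\<close>

lemma indep_var_weighted_sum:
  fixes X :: "'i \<Rightarrow> 'a \<Rightarrow> complex"
  assumes "i \<notin> I" and indep: "indep_vars (\<lambda>_. borel) X (insert i I)"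
  shows "indep_var borel (X i) borel (\<lambda>\<omega>. \<Sum>j\<in>I. complex_of_real (c j) * X j \<omega>)"
proof -
  have "indep_var
    borel ((\<lambda>f. f i) \<circ> (\<lambda>\<omega>. restrict (\<lambda>i. X i \<omega>) {i}))
    borel ((\<lambda>f. \<Sum>j\<in>I. complex_of_real (c j) * f j) \<circ> (\<lambda>\<omega>. restrict (\<lambda>i. X i \<omega>) I))"
    using assms(1) by (intro indep_var_compose[OF indep_var_restrict[OF indep]]) auto
  also have "((\<lambda>f. f i) \<circ> (\<lambda>\<omega>. restrict (\<lambda>i. X i \<omega>) {i})) = X i"
    by auto
  also have "((\<lambda>f. \<Sum>j\<in>I. complex_of_real (c j) * f j) \<circ> (\<lambda>\<omega>. restrict (\<lambda>i. X i \<omega>) I)) =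
      (\<lambda>\<omega>. \<Sum>j\<in>I. complex_of_real (c j) * X j \<omega>)"
    by (auto intro!: sum.cong)
  finally show ?thesis .
qed

text \<open>In the induction each new summand is the input of a Gaussian channel of gain
  \<open>c i\<close>, with the previous sum as noise. The base case is a singleton, since an empty
  sum is a point mass, which \<open>CN 0\<close> is not.\<close>

lemma distr_weighted_sum_CN:
  fixes X :: "'i \<Rightarrow> 'a \<Rightarrow> complex"
  assumes "finite I" "I \<noteq> {}" and "indep_vars (\<lambda>_. borel) X I"
    and "\<And>i. i \<in> I \<Longrightarrow> distr M borel (X i) = CN (v i)"
    and "\<And>i. i \<in> I \<Longrightarrow> v i > 0" and "\<And>i. i \<in> I \<Longrightarrow> c i \<noteq> 0"
  shows "distr M borel (\<lambda>\<omega>. \<Sum>i\<in>I. complex_of_real (c i) * X i \<omega>) = CN (\<Sum>i\<in>I. (c i)\<^sup>2 * v i)"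
  using assms
proof (induction I rule: finite_ne_induct)
  case (singleton i)
  have "X i \<in> borel_measurable M"
    using singleton(1) by (auto simp: indep_vars_def)
  then show ?case
    using distr_scale_CN[of "c i" "X i" "v i"] singleton by simp
next
  case (insert i I)
  have "indep_vars (\<lambda>_. borel) X I"
    using insert.prems(1) by (rule indep_vars_subset) auto
  then have "distr M borel (\<lambda>\<omega>. \<Sum>i\<in>I. complex_of_real (c i) * X i \<omega>) = CN (\<Sum>i\<in>I. (c i)\<^sup>2 * v i)"
    using insert by auto
  moreover have "(\<Sum>i\<in>I. (c i)\<^sup>2 * v i) > 0"
    using insert by (intro sum_pos) auto
  ultimately show ?case
    using distr_Gaussian_channel_output[OF _ _ indep_var_weighted_sum[OF insert.hyps(3) insert.prems(1)],
        of "v i" "\<Sum>i\<in>I. (c i)\<^sup>2 * v i" c "c i"] insert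
    by simp
qed

text \<open>All terms other than \<open>X i\<close> act together as one Gaussian noise that is
  independent of the input.\<close>

lemma mutual_information_weighted_sum_CN:
  fixes X :: "'i \<Rightarrow> 'a \<Rightarrow> complex"
  assumes "finite I" "I \<noteq> {}" "i \<notin> I" and indep: "indep_vars (\<lambda>_. borel) X (insert i I)"
    and X: "\<And>j. j \<in> insert i I \<Longrightarrow> distr M borel (X j) = CN (v j)"
    and v: "\<And>j. j \<in> insert i I \<Longrightarrow> v j > 0" and c: "\<And>j. j \<in> I \<Longrightarrow> c j \<noteq> 0"
  shows "mutual_information 2 borel borel (X i)
      (\<lambda>\<omega>. complex_of_real g * X i \<omega> + (\<Sum>j\<in>I. complex_of_real (c j) * X j \<omega>)) =
    log 2 (1 + g\<^sup>2 * v i / (\<Sum>j\<in>I. (c j)\<^sup>2 * v j))"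
proof (rule mutual_information_Gaussian_channel)
  show "v i > 0" "distr M borel (X i) = CN (v i)"
    using X v by auto
  show "(\<Sum>j\<in>I. (c j)\<^sup>2 * v j) > 0"
    using assms by (intro sum_pos) auto
  show "indep_var borel (X i) borel (\<lambda>\<omega>. \<Sum>j\<in>I. complex_of_real (c j) * X j \<omega>)"
    by (rule indep_var_weighted_sum[OF assms(3) indep])
  have "indep_vars (\<lambda>_. borel) X I"
    using indep by (rule indep_vars_subset) auto
  then show "distr M borel (\<lambda>\<omega>. \<Sum>j\<in>I. complex_of_real (c j) * X j \<omega>) = CN (\<Sum>j\<in>I. (c j)\<^sup>2 * v j)"
    using assms by (intro distr_weighted_sum_CN) auto
qed

end

text \<open>The law of the vector of coordinates is the product measure itself, hence the product of
  its marginals, which characterises independence. The common target \<open>B\<close> has the same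
  sets as every \<open>P i\<close>.\<close>

lemma indep_vars_PiM_coordinates:
  assumes "I \<noteq> {}" and P: "\<And>i. i \<in> I \<Longrightarrow> prob_space (P i)"
    and sets_P: "\<And>i. i \<in> I \<Longrightarrow> sets (P i) = sets B"
  shows "prob_space.indep_vars (PiM I P) (\<lambda>_. B) (\<lambda>i \<omega>. \<omega> i) I"
    and "\<And>i. i \<in> I \<Longrightarrow> distr (PiM I P) B (\<lambda>\<omega>. \<omega> i) = P i"
proof -
  interpret prob_space "PiM I P"
    by (rule prob_space_PiM) (rule P)
  have comp: "distr (PiM I P) B (\<lambda>\<omega>. \<omega> i) = P i" if "i \<in> I" for i
  proof -
    have "distr (PiM I P) B (\<lambda>\<omega>. \<omega> i) = distr (PiM I P) (P i) (\<lambda>\<omega>. \<omega> i)"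
      by (rule distr_cong) (auto simp: sets_P[OF that])
    also have "\<dots> = P i"
      using distr_PiM_component[of I P, OF P that] .
    finally show ?thesis .
  qed
  then show "\<And>i. i \<in> I \<Longrightarrow> distr (PiM I P) B (\<lambda>\<omega>. \<omega> i) = P i" .
  have meas: "(\<lambda>\<omega>. \<omega> i) \<in> PiM I P \<rightarrow>\<^sub>M B" if "i \<in> I" for i
    using measurable_component_singleton[OF that, of P] sets_P[OF that]
    by (simp cong: measurable_cong_sets)
  have "distr (PiM I P) (PiM I (\<lambda>_. B)) (\<lambda>\<omega>. \<lambda>i\<in>I. \<omega> i) = distr (PiM I P) (PiM I P) (\<lambda>\<omega>. \<omega>)"
  proof (rule distr_cong)
    show "sets (PiM I (\<lambda>_. B)) = sets (PiM I P)"
      by (intro sets_PiM_cong) (auto simp: sets_P)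
  qed (auto simp: space_PiM)
  also have "\<dots> = PiM I P"
    by simp
  also have "\<dots> = PiM I (\<lambda>i. distr (PiM I P) B (\<lambda>\<omega>. \<omega> i))"
    by (intro PiM_cong) (auto simp: comp)
  finally show "indep_vars (\<lambda>_. B) (\<lambda>i \<omega>. \<omega> i) I"
    by (subst indep_vars_iff_distr_eq_PiM'[OF assms(1)]) (auto intro: meas)
qed

section \<open>Receivers for time-hopping matrices\<close>

text \<open>A right inverse of a square matrix is also a left inverse, so the computed inverse
  exists, and uniqueness identifies it.\<close>

lemma the_mat_inverse_eqI:
  fixes A B :: "'a::field mat"
  assumes A: "A \<in> carrier_mat n n" and B: "B \<in> carrier_mat n n" and AB: "A * B = 1\<^sub>m n"
  shows "the (mat_inverse A) = B"
proof (cases "mat_inverse A")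
  case None
  then have "A \<notin> Units (ring_mat TYPE('a) n ())"
    by (rule mat_inverse(1)[OF A])
  moreover have "B * A = 1\<^sub>m n"
    by (rule mat_mult_left_right_inverse[OF A B AB])
  ultimately show ?thesis
    using A B AB by (auto simp: Units_def ring_mat_simps)
next
  case (Some C)
  then have C: "C * A = 1\<^sub>m n" "C \<in> carrier_mat n n"
    using mat_inverse(2)[OF A Some] by auto
  have "C = C * (A * B)"
    using C AB by simp
  also have "\<dots> = B"
    using A B C by (simp flip: assoc_mult_mat)
  finally show ?thesis
    using Some by simp
qed

lemma th_configsD:
  assumes "c \<in> th_configs N K" "k < K"
  shows "fst (c k) < N" "snd (c k) = - 1 \<or> snd (c k) = 1" "snd (c k) * snd (c k) = 1"
proof -
  have "c k \<in> {..<N} \<times> {- 1, 1}"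
    using assms by (auto simp: th_configs_def dest: PiE_mem)
  then show "fst (c k) < N" "snd (c k) = - 1 \<or> snd (c k) = 1" "snd (c k) * snd (c k) = 1"
    by auto
qed

text \<open>These are the diagonal entries of the Gram matrix of a time-hopping matrix.\<close>

definition row_count :: "nat \<Rightarrow> (nat \<Rightarrow> nat \<times> real) \<Rightarrow> nat \<Rightarrow> nat" where
  "row_count K c j = card {k\<in>{..<K}. fst (c k) = j}"

lemma th_matrix_gram:
  assumes c: "c \<in> th_configs N K"
  shows "th_matrix N K c * transpose_mat (th_matrix N K c) + t \<cdot>\<^sub>m 1\<^sub>m N =
    mat N N (\<lambda>(i, j). if i = j then real (row_count K c i) + t else 0)"
proof (rule eq_matI)
  fix i j assume "i < dim_row (mat N N (\<lambda>(i, j). if i = j then real (row_count K c i) + t else 0))"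
    and "j < dim_col (mat N N (\<lambda>(i, j). if i = j then real (row_count K c i) + t else 0))"
  then have ij: "i < N" "j < N" by auto
  have "(th_matrix N K c * transpose_mat (th_matrix N K c)) $$ (i, j) =
    (\<Sum>k<K. (if fst (c k) = i then snd (c k) else 0) * (if fst (c k) = j then snd (c k) else 0))"
    using ij by (simp add: th_matrix_def scalar_prod_def atLeast0LessThan)
  \<comment> \<open>A column has one nonzero entry, so a product survives only for
    \<open>i = j\<close>, where it is the square of a sign.\<close>
  also have "\<dots> = (\<Sum>k<K. if fst (c k) = i \<and> i = j then 1 else 0)"
    by (rule sum.cong) (use th_configsD(3)[OF c] in auto)
  also have "\<dots> = (if i = j then real (row_count K c i) else 0)"
    by (auto simp: row_count_def sum.If_cases Int_def)
  finally show "(th_matrix N K c * transpose_mat (th_matrix N K c) + t \<cdot>\<^sub>m 1\<^sub>m N) $$ (i, j) =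
     mat N N (\<lambda>(i, j). if i = j then real (row_count K c i) + t else 0) $$ (i, j)"
    using ij by (simp add: th_matrix_def)
qed (auto simp: th_matrix_def)

text \<open>The regularised Gram matrix is diagonal, and \<open>t > 0\<close> keeps its entries
  positive even in unoccupied rows, so inversion takes reciprocals.\<close>

lemma WT_pos_th_matrix:
  assumes c: "c \<in> th_configs N K" and t: "t > 0" and kj: "k < K" "j < N"
  shows "WT_pos t (th_matrix N K c) $$ (k, j) =
    (if fst (c k) = j then snd (c k) / (real (row_count K c j) + t) else 0)"
proof -
  let ?D = "mat N N (\<lambda>(i, j). if i = j then real (row_count K c i) + t else 0)"
  let ?E = "mat N N (\<lambda>(i, j). if i = j then 1 / (real (row_count K c i) + t) else 0)"
  have nz: "real (row_count K c i) + t \<noteq> 0" for i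
    using t by (smt (verit) of_nat_0_le_iff)
  have "?D * ?E = 1\<^sub>m N"
  proof (rule eq_matI)
    fix i j assume "i < dim_row (1\<^sub>m N :: real mat)" "j < dim_col (1\<^sub>m N :: real mat)"
    then have ij: "i < N" "j < N" by auto
    have "(?D * ?E) $$ (i, j) = (\<Sum>l<N. (if i = l then real (row_count K c i) + t else 0) *
        (if l = j then 1 / (real (row_count K c l) + t) else 0))"
      using ij by (simp add: scalar_prod_def atLeast0LessThan)
    also have "\<dots> = (\<Sum>l<N. if l = i then (if i = j then 1 else 0) else 0)"
      by (rule sum.cong) (use nz in auto)
    also have "\<dots> = 1\<^sub>m N $$ (i, j)"
      using ij by simp
    finally show "(?D * ?E) $$ (i, j) = 1\<^sub>m N $$ (i, j)" .
  qed auto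
  then have inv: "the (mat_inverse ?D) = ?E"
    by (intro the_mat_inverse_eqI[where n = N]) auto
  have "WT_pos t (th_matrix N K c) = transpose_mat (th_matrix N K c) * ?E"
    using th_matrix_gram[OF c, of t] inv by (simp add: WT_pos_def th_matrix_def)
  then have "WT_pos t (th_matrix N K c) $$ (k, j) = (\<Sum>l<N. (if fst (c k) = l then snd (c k) else 0) *
      (if l = j then 1 / (real (row_count K c l) + t) else 0))"
    using kj by (simp add: th_matrix_def scalar_prod_def atLeast0LessThan)
  also have "\<dots> = (\<Sum>l<N. if l = j then (if fst (c k) = j then snd (c k) / (real (row_count K c j) + t) else 0) else 0)"
    by (rule sum.cong) auto
  also have "\<dots> = (if fst (c k) = j then snd (c k) / (real (row_count K c j) + t) else 0)"
    using kj by simp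
  finally show ?thesis .
qed

lemma row_count_pos:
  assumes "k < K"
  shows "row_count K c (fst (c k)) > 0"
  unfolding row_count_def card_gt_0_iff using assms by auto

text \<open>For \<open>a = 0\<close> the formula is a right limit. In the row of user
  \<open>k\<close> the count is at least one, so the quotient is continuous at 0; elsewhere the
  entry vanishes identically.\<close>

lemma WT_th_matrix:
  assumes c: "c \<in> th_configs N K" and a: "a \<ge> 0" and kj: "k < K" "j < N"
  shows "WT a (th_matrix N K c) $$ (k, j) =
    (if fst (c k) = j then snd (c k) / (real (row_count K c j) + a) else 0)"
proof (cases "a > 0")
  case True
  then show ?thesis
    using WT_pos_th_matrix[OF c True kj] by (simp add: WT_def)
next
  case False
  then have [simp]: "a = 0" using a by simp
  let ?f = "\<lambda>t. if fst (c k) = j then snd (c k) / (real (row_count K c j) + t) else 0"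
  have "(?f \<longlongrightarrow> ?f 0) (at_right 0)"
  proof (cases "fst (c k) = j")
    case True
    then have "real (row_count K c j) + 0 \<noteq> 0"
      using row_count_pos[OF kj(1), of c] by auto
    then have "((\<lambda>t. snd (c k) / (real (row_count K c j) + t)) \<longlongrightarrow> snd (c k) / (real (row_count K c j) + 0)) (at_right 0)"
      by (intro tendsto_intros) auto
    then show ?thesis using True by simp
  qed simp
  \<comment> \<open>The closed form is available for positive \<open>t\<close> only, which suffices
    for this filter; the bound 1 is arbitrary.\<close>
  moreover have "\<forall>\<^sub>F t in at_right 0. WT_pos t (th_matrix N K c) $$ (k, j) = ?f t"
    unfolding eventually_at_right_field
    by (intro exI[of _ 1]) (use WT_pos_th_matrix[OF c _ kj] in auto)
  ultimately have "((\<lambda>t. WT_pos t (th_matrix N K c) $$ (k, j)) \<longlongrightarrow> ?f 0) (at_right 0)"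
    by (subst tendsto_cong)
  then have "Lim (at_right 0) (\<lambda>t. WT_pos t (th_matrix N K c) $$ (k, j)) = ?f 0"
    by (intro tendsto_Lim) simp
  then show ?thesis
    using kj by (simp add: WT_def th_matrix_def)
qed

text \<open>Index 0 is the user whose symbol is estimated, so the range starts at 1.\<close>

definition interferers :: "nat \<Rightarrow> (nat \<Rightarrow> nat \<times> real) \<Rightarrow> nat set" where
  "interferers K c = {k\<in>{1..<K}. fst (c k) = fst (c 0)}"

text \<open>Row 0 of the receiver has its only nonzero entry at the position of user 0, so a single
  received coordinate matters. One index set gathers the interfering symbols and the noise
  coordinate \<open>K + fst (c 0)\<close>, told apart by \<open>i < K\<close>. The parameter
  \<open>a\<close> enters through the gain \<open>q\<close> alone.\<close>

lemma r1_th_matrix: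
  assumes c: "c \<in> th_configs N K" and a: "a \<ge> 0" and K: "0 < K"
  defines "q \<equiv> 1 / (real (row_count K c (fst (c 0))) + a)"
  shows "r1 a (th_matrix N K c) \<omega> = complex_of_real q * \<omega> 0 +
    (\<Sum>i\<in>insert (K + fst (c 0)) (interferers K c).
      complex_of_real (q * snd (c 0) * (if i < K then snd (c i) else 1)) * \<omega> i)"
proof -
  let ?j = "fst (c 0)"
  have j: "?j < N"
    using th_configsD(1)[OF c K] .
  have dims: "dim_row (th_matrix N K c) = N" "dim_col (th_matrix N K c) = K"
    by (auto simp: th_matrix_def)
  let ?y = "\<lambda>j. (\<Sum>k<K. complex_of_real (th_matrix N K c $$ (j, k)) * \<omega> k) + \<omega> (K + j)"
  have "r1 a (th_matrix N K c) \<omega> = (\<Sum>j<N. if j = ?j then complex_of_real (q * snd (c 0)) * ?y ?j else 0)"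
    unfolding r1_def dims q_def
    by (rule sum.cong) (auto simp: WT_th_matrix[OF c a K])
  also have "\<dots> = complex_of_real (q * snd (c 0)) * ?y ?j"
    using j by simp
  also have "(\<Sum>k<K. complex_of_real (th_matrix N K c $$ (?j, k)) * \<omega> k) =
      (\<Sum>k<K. if fst (c k) = ?j then complex_of_real (snd (c k)) * \<omega> k else 0)"
    by (rule sum.cong) (use j in \<open>auto simp: th_matrix_def\<close>)
  also have "\<dots> = (\<Sum>k\<in>{k\<in>{..<K}. fst (c k) = ?j}. complex_of_real (snd (c k)) * \<omega> k)"
    by (rule sum.inter_filter[symmetric]) simp
  also have "{k\<in>{..<K}. fst (c k) = ?j} = insert 0 (interferers K c)"
    using K by (auto simp: interferers_def)
  also have "(\<Sum>k\<in>insert 0 (interferers K c). complex_of_real (snd (c k)) * \<omega> k) =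
      complex_of_real (snd (c 0)) * \<omega> 0 + (\<Sum>k\<in>interferers K c. complex_of_real (snd (c k)) * \<omega> k)"
    by (subst sum.insert) (auto simp: interferers_def)
  also have "complex_of_real (q * snd (c 0)) * (complex_of_real (snd (c 0)) * \<omega> 0 +
      (\<Sum>k\<in>interferers K c. complex_of_real (snd (c k)) * \<omega> k) + \<omega> (K + ?j)) =
    complex_of_real (q * (snd (c 0) * snd (c 0))) * \<omega> 0 +
      (complex_of_real (q * snd (c 0)) * \<omega> (K + ?j) +
      (\<Sum>k\<in>interferers K c. complex_of_real (q * snd (c 0)) * (complex_of_real (snd (c k)) * \<omega> k)))"
    by (simp add: algebra_simps sum_distrib_left)
  \<comment> \<open>The sign applied by the receiver matches that of the desired symbol, so their
    product is 1.\<close>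
  also have "complex_of_real (q * (snd (c 0) * snd (c 0))) = complex_of_real q"
    by (simp add: th_configsD(3)[OF c K])
  also have "(\<Sum>k\<in>interferers K c. complex_of_real (q * snd (c 0)) * (complex_of_real (snd (c k)) * \<omega> k)) =
    (\<Sum>i\<in>interferers K c. complex_of_real (q * snd (c 0) * (if i < K then snd (c i) else 1)) * \<omega> i)"
    by (rule sum.cong) (auto simp: interferers_def)
  also have "complex_of_real (q * snd (c 0)) * \<omega> (K + ?j) + \<dots> =
    (\<Sum>i\<in>insert (K + ?j) (interferers K c).
      complex_of_real (q * snd (c 0) * (if i < K then snd (c i) else 1)) * \<omega> i)"
    by (subst sum.insert) (auto simp: interferers_def)
  finally show ?thesis .
qed

text \<open>Signal, interference and noise carry the same squared gain \<open>q\<^sup>2\<close>,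
  which cancels and takes \<open>a\<close> with it. Signs square to one, so only the number of
  interferers remains.\<close>

lemma MI_given_S_th_matrix:
  assumes c: "c \<in> th_configs N K" and a: "a \<ge> 0" and K: "0 < K" and Es: "Es > 0" and N0: "N0 > 0"
  shows "MI_given_S N K Es N0 a (th_matrix N K c) =
    log 2 (1 + Es / (real (card (interferers K c)) * Es + N0))"
proof -
  let ?P = "\<lambda>i. if i < K then CN Es else CN N0"
  let ?v = "\<lambda>i. if i < K then Es else N0"
  define I where "I = insert (K + fst (c 0)) (interferers K c)"
  define q where "q = 1 / (real (row_count K c (fst (c 0))) + a)"
  have q: "q > 0"
    unfolding q_def using row_count_pos[OF K, of c] a by (simp add: add_pos_nonneg)
  let ?c = "\<lambda>i. q * snd (c 0) * (if i < K then snd (c i) else 1)"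
  interpret prob_space "noise_space N K Es N0"
    unfolding noise_space_def by (rule prob_space_PiM) (simp add: prob_space_CN Es N0)
  have P: "prob_space (?P i)" "sets (?P i) = sets borel" for i
    by (auto simp: prob_space_CN Es N0)
  have ne: "{..<K + N} \<noteq> {}"
    using K by (auto simp: lessThan_empty_iff)
  have sub: "insert 0 I \<subseteq> {..<K + N}"
    using th_configsD(1)[OF c K] K by (auto simp: I_def interferers_def)
  have indep: "indep_vars (\<lambda>_. borel) (\<lambda>i \<omega>. \<omega> i) {..<K + N}"
    unfolding noise_space_def by (rule indep_vars_PiM_coordinates(1)[OF ne P])
  have distr: "distr (noise_space N K Es N0) borel (\<lambda>\<omega>. \<omega> i) = CN (?v i)" if "i \<in> insert 0 I" for i
    unfolding noise_space_def using indep_vars_PiM_coordinates(2)[OF ne P, of i] that sub by auto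
  have fin: "finite (interferers K c)"
    by (simp add: interferers_def)
  have sgn: "snd (c i) \<noteq> 0" "(snd (c i))\<^sup>2 = 1" if "i < K" for i
    using th_configsD(3)[OF c that] by (auto simp: power2_eq_square)
  have "MI_given_S N K Es N0 a (th_matrix N K c) =
    mutual_information 2 borel borel (\<lambda>\<omega>. \<omega> 0) (\<lambda>\<omega>. complex_of_real q * \<omega> 0 + (\<Sum>i\<in>I. complex_of_real (?c i) * \<omega> i))"
    unfolding MI_given_S_def I_def q_def by (subst r1_th_matrix[OF c a K, abs_def]) (rule refl)
  also have "\<dots> = log 2 (1 + q\<^sup>2 * ?v 0 / (\<Sum>i\<in>I. (?c i)\<^sup>2 * ?v i))"
  proof (rule mutual_information_weighted_sum_CN[where X = "\<lambda>i \<omega>. \<omega> i"])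
    show "indep_vars (\<lambda>_. borel) (\<lambda>i \<omega>. \<omega> i) (insert 0 I)"
      using indep sub by (rule indep_vars_subset)
    show "?c i \<noteq> 0" if "i \<in> I" for i
      using q sgn(1) K by simp
  qed (use K Es N0 distr in \<open>auto simp: I_def interferers_def\<close>)
  also have "(\<Sum>i\<in>I. (?c i)\<^sup>2 * ?v i) = q\<^sup>2 * N0 + (\<Sum>i\<in>interferers K c. (?c i)\<^sup>2 * ?v i)"
    unfolding I_def
    by (subst sum.insert) (auto simp: interferers_def power_mult_distrib sgn K)
  also have "(\<Sum>i\<in>interferers K c. (?c i)\<^sup>2 * ?v i) = (\<Sum>i\<in>interferers K c. q\<^sup>2 * Es)"
    by (rule sum.cong) (auto simp: interferers_def power_mult_distrib sgn K)
  also have "q\<^sup>2 * ?v 0 / (q\<^sup>2 * N0 + (\<Sum>i\<in>interferers K c. q\<^sup>2 * Es)) =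
    (q\<^sup>2 * Es) / (q\<^sup>2 * (real (card (interferers K c)) * Es + N0))"
    using K by (simp add: algebra_simps)
  also have "\<dots> = Es / (real (card (interferers K c)) * Es + N0)"
    using q by simp
  finally show ?thesis .
qed

section \<open>Averaging over configurations\<close>

text \<open>Functions are grouped by the set \<open>A\<close> of arguments sent into
  \<open>P\<close>; the fibre over \<open>A\<close> is a product with factor \<open>P\<close> on
  \<open>A\<close> and \<open>B - P\<close> off \<open>A\<close>. Grouping the sets \<open>A\<close>
  by cardinality gives unnormalised binomial weights.\<close>

lemma sum_PiE_card_hits:
  fixes f :: "nat \<Rightarrow> real"
  assumes I: "finite I" and B: "finite B" and P: "P \<subseteq> B"
  shows "(\<Sum>c\<in>I \<rightarrow>\<^sub>E B. f (card {i\<in>I. c i \<in> P})) =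
    (\<Sum>k\<le>card I. real (card I choose k) * real (card P) ^ k * real (card (B - P)) ^ (card I - k) * f k)"
proof -
  have fin: "finite (I \<rightarrow>\<^sub>E B)"
    using I B by (intro finite_PiE) auto
  have fibre: "{c \<in> I \<rightarrow>\<^sub>E B. {i\<in>I. c i \<in> P} = A} = (\<Pi>\<^sub>E i\<in>I. if i \<in> A then P else B - P)"
    if "A \<subseteq> I" for A
  proof -
    have "{i\<in>I. c i \<in> P} = A \<longleftrightarrow> (\<forall>i\<in>I. c i \<in> P \<longleftrightarrow> i \<in> A)" for c
      using that by blast
    moreover have "c i \<in> (if i \<in> A then P else B - P) \<longleftrightarrow> c i \<in> B \<and> (c i \<in> P \<longleftrightarrow> i \<in> A)" for c i
      using P by auto
    ultimately show ?thesis
      by (simp only: PiE_iff set_eq_iff mem_Collect_eq ball_conj_distrib) blast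
  qed
  have card_fibre: "card (\<Pi>\<^sub>E i\<in>I. if i \<in> A then P else B - P) = card P ^ card A * card (B - P) ^ (card I - card A)"
    if "A \<subseteq> I" for A
  proof -
    have "card (\<Pi>\<^sub>E i\<in>I. if i \<in> A then P else B - P) = (\<Prod>i\<in>I. if i \<in> A then card P else card (B - P))"
      using I by (simp add: card_PiE if_distrib cong: if_cong)
    also have "\<dots> = card P ^ card (I \<inter> A) * card (B - P) ^ card (I - A)"
      using I by (simp add: prod.If_cases Diff_eq)
    also have "I \<inter> A = A"
      using that by auto
    also have "card (I - A) = card I - card A"
      using that I by (intro card_Diff_subset) (auto intro: finite_subset)
    finally show ?thesis .
  qed
  have "(\<Sum>c\<in>I \<rightarrow>\<^sub>E B. f (card {i\<in>I. c i \<in> P})) =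
    (\<Sum>A\<in>Pow I. \<Sum>c\<in>{c \<in> I \<rightarrow>\<^sub>E B. {i\<in>I. c i \<in> P} = A}. f (card {i\<in>I. c i \<in> P}))"
    by (rule sum.group[symmetric]) (use fin I in auto)
  also have "\<dots> = (\<Sum>A\<in>Pow I. real (card P) ^ card A * real (card (B - P)) ^ (card I - card A) * f (card A))"
  proof (rule sum.cong[OF refl])
    fix A assume "A \<in> Pow I"
    then have A: "A \<subseteq> I" by simp
    have "(\<Sum>c\<in>{c \<in> I \<rightarrow>\<^sub>E B. {i\<in>I. c i \<in> P} = A}. f (card {i\<in>I. c i \<in> P})) =
      (\<Sum>c\<in>{c \<in> I \<rightarrow>\<^sub>E B. {i\<in>I. c i \<in> P} = A}. f (card A))"
      by (rule sum.cong) auto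
    also have "\<dots> = real (card P) ^ card A * real (card (B - P)) ^ (card I - card A) * f (card A)"
      by (simp add: fibre[OF A] card_fibre[OF A])
    finally show "(\<Sum>c\<in>{c \<in> I \<rightarrow>\<^sub>E B. {i\<in>I. c i \<in> P} = A}. f (card {i\<in>I. c i \<in> P})) =
      real (card P) ^ card A * real (card (B - P)) ^ (card I - card A) * f (card A)" .
  qed
  also have "\<dots> = (\<Sum>k\<le>card I. \<Sum>A\<in>{A\<in>Pow I. card A = k}.
      real (card P) ^ card A * real (card (B - P)) ^ (card I - card A) * f (card A))"
    by (rule sum.group[symmetric]) (use I in \<open>auto intro: card_mono\<close>)
  also have "\<dots> = (\<Sum>k\<le>card I. real (card I choose k) * real (card P) ^ k * real (card (B - P)) ^ (card I - k) * f k)"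
  proof (rule sum.cong)
    fix k
    have "(\<Sum>A\<in>{A\<in>Pow I. card A = k}.
      real (card P) ^ card A * real (card (B - P)) ^ (card I - card A) * f (card A)) =
      (\<Sum>A\<in>{A\<in>Pow I. card A = k}. real (card P) ^ k * real (card (B - P)) ^ (card I - k) * f k)"
      by (rule sum.cong) auto
    also have "\<dots> = real (card {A\<in>Pow I. card A = k}) * (real (card P) ^ k * real (card (B - P)) ^ (card I - k) * f k)"
      by simp
    also have "card {A\<in>Pow I. card A = k} = card I choose k"
      using n_subsets[OF I, of k] by (simp add: Pow_def)
    finally show "(\<Sum>A\<in>{A\<in>Pow I. card A = k}.
      real (card P) ^ card A * real (card (B - P)) ^ (card I - card A) * f (card A)) =
      real (card I choose k) * real (card P) ^ k * real (card (B - P)) ^ (card I - k) * f k"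
      by (simp add: mult.assoc)
  qed simp
  finally show ?thesis .
qed

text \<open>Conversion from probabilities to counts: with \<open>x\<close> rows there are
  \<open>2 * x\<close> choices of row and sign, of which 2 hit a given row and
  \<open>2 * (x - 1)\<close> miss it.\<close>

lemma power_mult_binomial_term:
  fixes x :: real
  assumes "x \<noteq> 0" "k \<le> n"
  shows "(2 * x) ^ n * (w * (1 / x) ^ k * (1 - 1 / x) ^ (n - k) * z) = w * 2 ^ k * (2 * (x - 1)) ^ (n - k) * z"
proof -
  obtain m where n: "n = k + m"
    using assms(2) le_Suc_ex by blast
  have k: "(2 * x) ^ k * (1 / x) ^ k = 2 ^ k"
    unfolding power_mult_distrib[symmetric] using assms(1) by simp
  have "2 * x * (1 - 1 / x) = 2 * (x - 1)"
    using assms(1) by (simp add: right_diff_distrib)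
  then have m: "(2 * x) ^ m * (1 - 1 / x) ^ m = (2 * (x - 1)) ^ m"
    unfolding power_mult_distrib[symmetric] by (rule arg_cong)
  have "(2 * x) ^ n * (w * (1 / x) ^ k * (1 - 1 / x) ^ m * z) =
    w * ((2 * x) ^ k * (1 / x) ^ k) * ((2 * x) ^ m * (1 - 1 / x) ^ m) * z"
    unfolding n power_add by (simp only: mult_ac)
  then show ?thesis
    unfolding k m by (simp only: n add_diff_cancel_left')
qed

text \<open>Whatever the choice of user 0, each of the other \<open>K - 1\<close> users lands in its
  row independently with probability \<open>1 / N\<close>, so the number of interferers is
  binomial.\<close>

lemma average_interferers:
  fixes f :: "nat \<Rightarrow> real"
  assumes N: "0 < N" and K: "0 < K"
  shows "(\<Sum>c\<in>th_configs N K. f (card (interferers K c))) / real (card (th_configs N K)) =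
    (\<Sum>k\<le>K - 1. real (K - 1 choose k) * (1 / real N) ^ k * (1 - 1 / real N) ^ (K - 1 - k) * f k)"
proof -
  define B :: "(nat \<times> real) set" where "B = {..<N} \<times> {- 1, 1}"
  have B: "finite B" "card B = 2 * N"
    by (auto simp: B_def card_cartesian_product)
  have ins: "{..<K} = insert 0 {1..<K}"
    using K by auto
  have configs: "th_configs N K = (\<lambda>(b, c). c(0 := b)) ` (B \<times> ({1..<K} \<rightarrow>\<^sub>E B))"
    unfolding th_configs_def B_def[symmetric] ins by (rule PiE_insert_eq)
  have inj: "inj_on (\<lambda>(b, c). c(0 := b)) (B \<times> ({1..<K} \<rightarrow>\<^sub>E B))"
    using inj_combinator[of 0 "{1..<K}" "\<lambda>_. B"] by simp
  have "(\<Sum>c\<in>th_configs N K. f (card (interferers K c))) =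
    (\<Sum>(b, c)\<in>B \<times> ({1..<K} \<rightarrow>\<^sub>E B). f (card (interferers K (c(0 := b)))))"
    unfolding configs by (subst sum.reindex[OF inj]) (simp add: case_prod_beta comp_def)
  also have "\<dots> = (\<Sum>b\<in>B. \<Sum>c\<in>{1..<K} \<rightarrow>\<^sub>E B. f (card (interferers K (c(0 := b)))))"
    by (rule sum.cartesian_product[symmetric])
  also have "\<dots> = (\<Sum>b\<in>B. \<Sum>k\<le>K - 1. real (K - 1 choose k) * 2 ^ k * (2 * (real N - 1)) ^ (K - 1 - k) * f k)"
  proof (rule sum.cong[OF refl])
    fix b assume b: "b \<in> B"
    \<comment> \<open>\<open>P\<close> holds both signs in the row of \<open>b\<close>, so hitting
      \<open>P\<close> means sharing that row.\<close>
    define P :: "(nat \<times> real) set" where "P = {fst b} \<times> {- 1, 1}"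
    have P: "P \<subseteq> B" "card P = 2"
      using b by (auto simp: P_def B_def card_cartesian_product)
    have cBP: "real (card (B - P)) = 2 * (real N - 1)"
    proof -
      have "finite P"
        by (simp add: P_def)
      then have "card (B - P) = 2 * N - 2"
        using P B by (simp add: card_Diff_subset)
      then show ?thesis
        using N by simp
    qed
    have "(\<Sum>c\<in>{1..<K} \<rightarrow>\<^sub>E B. f (card (interferers K (c(0 := b))))) =
      (\<Sum>c\<in>{1..<K} \<rightarrow>\<^sub>E B. f (card {i\<in>{1..<K}. c i \<in> P}))"
    proof (rule sum.cong[OF refl])
      fix c assume c: "c \<in> {1..<K} \<rightarrow>\<^sub>E B"
      have "interferers K (c(0 := b)) = {i\<in>{1..<K}. c i \<in> P}"
      proof -
        have "fst (c k) = fst b \<longleftrightarrow> c k \<in> P" if "k \<in> {1..<K}" for k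
          using PiE_mem[OF c that] by (cases "c k") (auto simp: P_def B_def)
        then show ?thesis
          by (auto simp: interferers_def)
      qed
      then show "f (card (interferers K (c(0 := b)))) = f (card {i\<in>{1..<K}. c i \<in> P})"
        by simp
    qed
    also have "\<dots> = (\<Sum>k\<le>K - 1. real (K - 1 choose k) * 2 ^ k * (2 * (real N - 1)) ^ (K - 1 - k) * f k)"
      by (subst sum_PiE_card_hits) (use B P in \<open>auto simp: cBP\<close>)
    finally show "(\<Sum>c\<in>{1..<K} \<rightarrow>\<^sub>E B. f (card (interferers K (c(0 := b))))) =
      (\<Sum>k\<le>K - 1. real (K - 1 choose k) * 2 ^ k * (2 * (real N - 1)) ^ (K - 1 - k) * f k)" .
  qed
  also have "\<dots> = (2 * real N) * (\<Sum>k\<le>K - 1. real (K - 1 choose k) * 2 ^ k * (2 * (real N - 1)) ^ (K - 1 - k) * f k)"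
    using B by simp
  \<comment> \<open>One factor \<open>2 * N\<close> counts the choices of user 0; the other
    \<open>K - 1\<close> factors normalise the binomial weights.\<close>
  also have "\<dots> = (2 * real N) ^ K * (\<Sum>k\<le>K - 1. real (K - 1 choose k) * (1 / real N) ^ k * (1 - 1 / real N) ^ (K - 1 - k) * f k)"
  proof -
    have "(2 * real N) ^ K = (2 * real N) * (2 * real N) ^ (K - 1)"
      using K by (cases K) auto
    moreover have "(2 * real N) ^ (K - 1) *
        (\<Sum>k\<le>K - 1. real (K - 1 choose k) * (1 / real N) ^ k * (1 - 1 / real N) ^ (K - 1 - k) * f k) =
      (\<Sum>k\<le>K - 1. real (K - 1 choose k) * 2 ^ k * (2 * (real N - 1)) ^ (K - 1 - k) * f k)"
      unfolding sum_distrib_left by (rule sum.cong[OF refl], rule power_mult_binomial_term) (use N in auto)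
    ultimately show ?thesis
      by simp
  qed
  finally have *: "(\<Sum>c\<in>th_configs N K. f (card (interferers K c))) =
    (2 * real N) ^ K * (\<Sum>k\<le>K - 1. real (K - 1 choose k) * (1 / real N) ^ k * (1 - 1 / real N) ^ (K - 1 - k) * f k)" .
  have "card (th_configs N K) = (2 * N) ^ K"
    unfolding th_configs_def B_def[symmetric] using B by (simp add: card_PiE)
  then show ?thesis
    unfolding * using N by simp
qed

lemma cond_MI_eq_binomial_sum:
  assumes "0 < N" "0 < K" "a \<ge> 0" "Es > 0" "N0 > 0"
  shows "cond_MI N K Es N0 a =
    (\<Sum>k\<le>K - 1. real (K - 1 choose k) * (1 / real N) ^ k * (1 - 1 / real N) ^ (K - 1 - k) *
      log 2 (1 + Es / (real k * Es + N0)))"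
proof -
  have "cond_MI N K Es N0 a =
    (\<Sum>c\<in>th_configs N K. log 2 (1 + Es / (real (card (interferers K c)) * Es + N0))) / real (card (th_configs N K))"
    unfolding cond_MI_def using assms by (simp add: MI_given_S_th_matrix)
  also have "\<dots> = (\<Sum>k\<le>K - 1. real (K - 1 choose k) * (1 / real N) ^ k * (1 - 1 / real N) ^ (K - 1 - k) *
      log 2 (1 + Es / (real k * Es + N0)))"
    by (rule average_interferers[OF assms(1,2)])
  finally show ?thesis .
qed

section \<open>Poisson limit\<close>

text \<open>The falling factorial is at most the power. This bound supplies the dominating sequence
  for the Poisson limit.\<close>

lemma choose_mult_power_le:
  fixes p :: real
  assumes "p \<ge> 0"
  shows "real (n choose k) * p ^ k \<le> (real n * p) ^ k / fact k"
proof -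
  have "real (n choose k) * fact k \<le> real n ^ k"
    using binomial_fact_pow[of n k] by (metis of_nat_fact of_nat_le_iff of_nat_mult of_nat_power)
  then have "real (n choose k) \<le> real n ^ k / fact k"
    by (simp add: field_simps)
  then have "real (n choose k) * p ^ k \<le> real n ^ k / fact k * p ^ k"
    using assms by (intro mult_right_mono) auto
  then show ?thesis
    by (simp add: power_mult_distrib)
qed

text \<open>For fixed \<open>k\<close> the binomial coefficient has \<open>k\<close> factors of the
  form \<open>n - i\<close>. Each absorbs one \<open>p\<close>, and the correction
  \<open>i * p\<close> vanishes in the limit.\<close>

lemma tendsto_choose_mult_power:
  fixes p :: "nat \<Rightarrow> real"
  assumes np: "(\<lambda>N. real (n N) * p N) \<longlonglongrightarrow> \<beta>" and p: "p \<longlonglongrightarrow> 0"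
  shows "(\<lambda>N. real (n N choose k) * p N ^ k) \<longlonglongrightarrow> \<beta> ^ k / fact k"
proof -
  have "real (n N choose k) * p N ^ k = (\<Prod>i<k. real (n N) * p N - real i * p N) / fact k" for N
    by (simp add: binomial_gbinomial gbinomial_prod_rev atLeast0LessThan left_diff_distrib[symmetric] prod.distrib)
  moreover have "(\<lambda>N. (\<Prod>i<k. real (n N) * p N - real i * p N) / fact k) \<longlonglongrightarrow> (\<Prod>i<k. \<beta> - real i * 0) / fact k"
    by (intro tendsto_intros np p) simp
  ultimately show ?thesis
    by simp
qed

text \<open>The power is written as \<open>((1 - p) powr (1 / p)) powr (n * p)\<close>, whose inner
  base tends to \<open>exp (- 1)\<close>.\<close>

lemma tendsto_one_minus_power:
  fixes p :: "nat \<Rightarrow> real"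
  assumes np: "(\<lambda>N. real (n N) * p N) \<longlonglongrightarrow> \<beta>" and p: "p \<longlonglongrightarrow> 0" and pos: "\<forall>\<^sub>F N in sequentially. p N > 0"
  shows "(\<lambda>N. (1 - p N) ^ n N) \<longlonglongrightarrow> exp (- \<beta>)"
proof -
  have "filterlim p (at_right 0) sequentially"
    using p pos by (intro tendsto_imp_filterlim_at_right) auto
  then have "(\<lambda>N. (1 + (-1) * p N) powr (1 / p N)) \<longlonglongrightarrow> exp (- 1)"
    by (rule filterlim_compose[OF tendsto_exp_limit_at_right])
  then have "(\<lambda>N. ((1 + (-1) * p N) powr (1 / p N)) powr (real (n N) * p N)) \<longlonglongrightarrow> exp (- 1) powr \<beta>"
    by (intro tendsto_powr np) auto
  \<comment> \<open>This makes the base positive, so that \<open>powr\<close> agrees with the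
    natural power.\<close>
  moreover have "\<forall>\<^sub>F N in sequentially. p N < 1"
    using p by (rule order_tendstoD) simp
  with pos have "\<forall>\<^sub>F N in sequentially. ((1 + (-1) * p N) powr (1 / p N)) powr (real (n N) * p N) = (1 - p N) ^ n N"
    by eventually_elim (simp add: powr_powr powr_realpow)
  ultimately show ?thesis
    by (simp add: tendsto_cong exp_powr_real)
qed

lemma tendsto_binomial_term:
  fixes p :: "nat \<Rightarrow> real"
  assumes np: "(\<lambda>N. real (n N) * p N) \<longlonglongrightarrow> \<beta>" and p: "p \<longlonglongrightarrow> 0"
    and pos: "\<forall>\<^sub>F N in sequentially. p N > 0" and n: "filterlim n at_top sequentially"
  shows "(\<lambda>N. real (n N choose k) * p N ^ k * (1 - p N) ^ (n N - k)) \<longlonglongrightarrow> \<beta> ^ k * exp (- \<beta>) / fact k"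
proof -
  have "(\<lambda>N. (1 - p N) ^ n N / (1 - p N) ^ k) \<longlonglongrightarrow> exp (- \<beta>) / (1 - 0) ^ k"
    by (intro tendsto_intros p tendsto_one_minus_power[OF np p pos]) simp
  then have lim: "(\<lambda>N. real (n N choose k) * p N ^ k * ((1 - p N) ^ n N / (1 - p N) ^ k)) \<longlonglongrightarrow>
      \<beta> ^ k / fact k * (exp (- \<beta>) / (1 - 0) ^ k)"
    by (intro tendsto_mult tendsto_choose_mult_power[OF np p])
  have "\<forall>\<^sub>F N in sequentially. p N < 1"
    using p by (rule order_tendstoD) simp
  \<comment> \<open>From here on the truncated subtraction \<open>n N - k\<close> is a true one, and
    the power splits as a quotient.\<close>
  moreover have "\<forall>\<^sub>F N in sequentially. k \<le> n N"
    using n by (simp add: filterlim_at_top)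
  ultimately have "\<forall>\<^sub>F N in sequentially. real (n N choose k) * p N ^ k * ((1 - p N) ^ n N / (1 - p N) ^ k) =
      real (n N choose k) * p N ^ k * (1 - p N) ^ (n N - k)"
    by eventually_elim (simp add: power_diff)
  with lim have "(\<lambda>N. real (n N choose k) * p N ^ k * (1 - p N) ^ (n N - k)) \<longlonglongrightarrow>
      \<beta> ^ k / fact k * (exp (- \<beta>) / (1 - 0) ^ k)"
    by (rule Lim_transform_eventually)
  then show ?thesis
    by simp
qed

text \<open>Dominated convergence for series, applied to the termwise Poisson limit. Since
  \<open>n * p\<close> is eventually below \<open>\<bar>\<beta>\<bar> + 1\<close> and
  \<open>f\<close> is bounded, an exponential series is a summable majorant.\<close>

lemma tendsto_binomial_sum_Poisson:
  fixes p :: "nat \<Rightarrow> real" and f :: "nat \<Rightarrow> real"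
  assumes np: "(\<lambda>N. real (n N) * p N) \<longlonglongrightarrow> \<beta>" and p: "p \<longlonglongrightarrow> 0"
    and pos: "\<forall>\<^sub>F N in sequentially. p N > 0" and n: "filterlim n at_top sequentially"
    and f: "\<And>k. \<bar>f k\<bar> \<le> C"
  shows "(\<lambda>N. \<Sum>k\<le>n N. real (n N choose k) * p N ^ k * (1 - p N) ^ (n N - k) * f k)
    \<longlonglongrightarrow> (\<Sum>k. \<beta> ^ k * exp (- \<beta>) / fact k * f k)"
proof -
  let ?a = "\<lambda>k N. real (n N choose k) * p N ^ k * (1 - p N) ^ (n N - k) * f k"
  let ?M = "\<lambda>k. (\<bar>\<beta>\<bar> + 1) ^ k / fact k * C"
  have C: "C \<ge> 0"
    using f[of 0] by linarith
  have "\<forall>\<^sub>F N in sequentially. \<forall>k. norm (?a k N) \<le> ?M k"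
  proof -
    have "\<forall>\<^sub>F N in sequentially. p N < 1"
      using p by (rule order_tendstoD) simp
    moreover have "\<forall>\<^sub>F N in sequentially. real (n N) * p N < \<bar>\<beta>\<bar> + 1"
      using np by (rule order_tendstoD) simp
    ultimately show ?thesis
      using pos
    proof eventually_elim
      case (elim N)
      show ?case
      proof
        fix k
        have "real (n N choose k) * p N ^ k \<le> (real (n N) * p N) ^ k / fact k"
          using elim by (intro choose_mult_power_le) simp
        also have "\<dots> \<le> (\<bar>\<beta>\<bar> + 1) ^ k / fact k"
          using elim by (intro divide_right_mono power_mono) auto
        finally have "real (n N choose k) * p N ^ k * (1 - p N) ^ (n N - k) \<le> (\<bar>\<beta>\<bar> + 1) ^ k / fact k * 1"
          using elim by (intro mult_mono power_le_one) auto
        then have "real (n N choose k) * p N ^ k * (1 - p N) ^ (n N - k) * \<bar>f k\<bar> \<le> ?M k"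
          using f[of k] by (intro mult_mono) auto
        then show "norm (?a k N) \<le> ?M k"
          using elim by (simp add: abs_mult)
      qed
    qed
  qed
  \<comment> \<open>Domination holds for all \<open>k\<close> at once, so the product filter puts
    the trivial condition on \<open>k\<close>.\<close>
  then have bound: "\<forall>\<^sub>F (k, N) in at_top \<times>\<^sub>F sequentially. norm (?a k N) \<le> ?M k"
    unfolding eventually_prod_filter
    by (intro exI[of _ "\<lambda>_. True"] exI[of _ "\<lambda>N. \<forall>k. norm (?a k N) \<le> ?M k"]) auto
  have summ: "summable ?M"
    using summable_exp_generic[of "\<bar>\<beta>\<bar> + 1"]
    by (intro summable_mult2) (simp add: divide_inverse mult.commute)
  have "(\<lambda>N. \<Sum>k. ?a k N) \<longlonglongrightarrow> (\<Sum>k. \<beta> ^ k * exp (- \<beta>) / fact k * f k)"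
    using tannerys_theorem[OF _ bound summ, of "\<lambda>k. \<beta> ^ k * exp (- \<beta>) / fact k * f k"]
      tendsto_mult_right[OF tendsto_binomial_term[OF np p pos n]]
    by simp
  \<comment> \<open>Binomial coefficients vanish for \<open>k > n N\<close>, so the series is the
    finite sum.\<close>
  moreover have "(\<Sum>k. ?a k N) = (\<Sum>k\<le>n N. ?a k N)" for N
    by (rule suminf_finite) (auto simp: binomial_eq_0)
  ultimately show ?thesis
    by simp
qed

theorem theorem6:
  fixes \<beta> Es N0 \<alpha> :: real and K :: "nat \<Rightarrow> nat"
  assumes "\<beta> > 0" and "Es > 0" and "N0 > 0"
    and "(\<lambda>N. real (K N) / real N) \<longlonglongrightarrow> \<beta>"
    and "\<alpha> \<in> {0, 1 / (Es / N0)}"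
  shows "(\<lambda>N. \<beta> * cond_MI N (K N) Es N0 \<alpha>) \<longlonglongrightarrow>
           \<beta> * (\<Sum>k. \<beta>^k * exp (-\<beta>) / fact k *
                      log 2 (1 + (Es / N0) / (real k * (Es / N0) + 1)))"
proof (rule tendsto_mult_left)
  let ?f = "\<lambda>k. log 2 (1 + Es / (real k * Es + N0))"
  have \<alpha>: "\<alpha> \<ge> 0"
    using assms by auto
  have N_pos: "\<forall>\<^sub>F N in sequentially. (0::nat) < N"
    by (rule eventually_gt_at_top)
  have inv: "(\<lambda>N. 1 / real N) \<longlonglongrightarrow> 0"
    by (rule lim_1_over_n)
  \<comment> \<open>\<open>K N\<close> tends to infinity, being the product of \<open>N\<close> and
    a ratio with positive limit.\<close>
  have "filterlim (\<lambda>N. real (K N) / real N * real N) at_top sequentially"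
    by (rule filterlim_tendsto_pos_mult_at_top[OF assms(4,1) filterlim_real_sequentially])
  moreover have *: "\<forall>\<^sub>F N in sequentially. real (K N) / real N * real N = real (K N)"
    using N_pos by eventually_elim simp
  ultimately have "filterlim (\<lambda>N. real (K N)) at_top sequentially"
    by (simp only: filterlim_cong[OF refl refl *])
  then have K_top: "filterlim K at_top sequentially"
    by (simp add: filterlim_sequentially_iff_filterlim_real)
  then have K_pos: "\<forall>\<^sub>F N in sequentially. 0 < K N"
    by (auto simp: filterlim_at_top Suc_le_eq dest: spec[of _ 1])
  \<comment> \<open>Only the other \<open>K N - 1\<close> users can interfere; passing to them
    changes the load by \<open>1 / N\<close>, which vanishes.\<close>
  have "(\<lambda>N. real (K N) / real N - 1 / real N) \<longlonglongrightarrow> \<beta> - 0"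
    by (intro tendsto_diff assms(4) inv)
  moreover have "\<forall>\<^sub>F N in sequentially. real (K N) / real N - 1 / real N = real (K N - 1) * (1 / real N)"
    using K_pos by eventually_elim (simp add: diff_divide_distrib of_nat_diff)
  ultimately have "(\<lambda>N. real (K N - 1) * (1 / real N)) \<longlonglongrightarrow> \<beta> - 0"
    by (rule Lim_transform_eventually)
  then have np: "(\<lambda>N. real (K N - 1) * (1 / real N)) \<longlonglongrightarrow> \<beta>"
    by simp
  have "filterlim (\<lambda>N. K N - 1) at_top sequentially"
    by (rule filterlim_compose[OF filterlim_minus_const_nat_at_top K_top])
  \<comment> \<open>Information decreases with the number of interferers, so the interference-free
    value is a bound.\<close>
  moreover have "\<bar>?f k\<bar> \<le> ?f 0" for k
  proof -
    have "Es / (real k * Es + N0) \<le> Es / (real 0 * Es + N0)"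
      using assms by (intro divide_left_mono mult_pos_pos add_nonneg_pos add_right_mono mult_right_mono) auto
    moreover have "0 \<le> Es / (real k * Es + N0)"
      using assms by simp
    ultimately show ?thesis
      by (simp add: zero_le_log_cancel_iff)
  qed
  moreover have "\<forall>\<^sub>F N in sequentially. 1 / real N > 0"
    using N_pos by eventually_elim simp
  ultimately have "(\<lambda>N. \<Sum>k\<le>K N - 1. real (K N - 1 choose k) * (1 / real N) ^ k * (1 - 1 / real N) ^ (K N - 1 - k) * ?f k)
    \<longlonglongrightarrow> (\<Sum>k. \<beta> ^ k * exp (- \<beta>) / fact k * ?f k)"
    by (intro tendsto_binomial_sum_Poisson[OF np inv])
  \<comment> \<open>The binomial formula assumes at least one row and one user, which holds for all
    large \<open>N\<close>.\<close>
  moreover have "\<forall>\<^sub>F N in sequentially. (\<Sum>k\<le>K N - 1. real (K N - 1 choose k) * (1 / real N) ^ k *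
      (1 - 1 / real N) ^ (K N - 1 - k) * ?f k) = cond_MI N (K N) Es N0 \<alpha>"
    using N_pos K_pos by eventually_elim (simp only: cond_MI_eq_binomial_sum[OF _ _ \<alpha> assms(2,3)])
  ultimately have "(\<lambda>N. cond_MI N (K N) Es N0 \<alpha>) \<longlonglongrightarrow> (\<Sum>k. \<beta> ^ k * exp (- \<beta>) / fact k * ?f k)"
    by (rule Lim_transform_eventually)
  \<comment> \<open>Dividing through by \<open>N0\<close> expresses the limit in the signal-to-noise
    ratio.\<close>
  moreover have "Es / (real k * Es + N0) = (Es / N0) / (real k * (Es / N0) + 1)" for k
  proof -
    have "real k * Es + N0 > 0"
      using assms by (intro add_nonneg_pos) auto
    then show ?thesis
      using assms by (simp add: divide_simps)
  qed
  ultimately show "(\<lambda>N. cond_MI N (K N) Es N0 \<alpha>) \<longlonglongrightarrow>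
     (\<Sum>k. \<beta>^k * exp (-\<beta>) / fact k * log 2 (1 + (Es / N0) / (real k * (Es / N0) + 1)))"
    by (simp only:)
qed

end
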